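(* Let $\mathcal{GJL}_{CS}$ be any one of the calculi $\mathcal{GJ}_{CS},\mathcal{GJT}_{CS},\mathcal{GJ}4_{CS},\mathcal{GLP}_{CS},\mathcal{GJ}45_{CS},\mathcal{GJT}45_{CS}$, where $CS$ is a constant specification for that calculus, and let $\mathsf{GJL_{CS}}$ be the corresponding model class, namely $\mathsf{GJ_{CS}},\mathsf{GJT_{CS}},\mathsf{GJ4_{CS}},\mathsf{GLP_{CS}},\mathsf{GJ45_{CS}},\mathsf{GJT45_{CS}}$ respectively, and $\mathsf{GJL_{CS}c}$ its subclass of crisp models. Then for any $\Gamma\cup\{\phi\}\subseteq\mathcal{L}_J$ the following are equivalent: (i) $\Gamma\vdash_{\mathcal{GJL}_{CS}}\phi$; (ii) $\Gamma\models_{\mathsf{GJL_{CS}}\leq}\phi$; (iii) $\Gamma\models_{\mathsf{GJL_{CS}}}\phi$; (iv) $\Gamma\models_{\mathsf{GJL_{CS}c}}\phi$.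
   Context: Truth functions on $[0,1]$: $x\odot y=\min\{x,y\}$; $x\Rightarrow y=1$ if $x\le y$ and $x\Rightarrow y=y$ otherwise; $\sim x=1$ if $x=0$ and $\sim x=0$ otherwise; $x\oplus y=\max\{x,y\}$. Justification terms $Jt$: $t::=x\mid c\mid[t\cdot t]\mid[t+t]\mid\,!t\mid\,?t$, with $x$ ranging over countably many term variables and $c$ over countably many constants. Formulas $\mathcal{L}_J$: $\phi::=\bot\mid p\mid(\phi\land\phi)\mid(\phi\rightarrow\phi)\mid t:\phi$ with $p\in Var=\{p_i\mid i\in\mathbb{N}\}$, $t\in Jt$; $\neg\phi:=\phi\rightarrow\bot$. Calculi: $\mathcal{G}$ has the axiom schemes (A1) $(\phi\to\psi)\to((\psi\to\chi)\to(\phi\to\chi))$, (A2) $(\phi\land\psi)\to\phi$, (A3) $(\phi\land\psi)\to(\psi\land\phi)$, (A5a) $(\phi\to(\psi\to\chi))\to((\phi\land\psi)\to\chi)$, (A5b) $((\phi\land\psi)\to\chi)\to(\phi\to(\psi\to\chi))$, (A6) $((\phi\to\psi)\to\chi)\to(((\psi\to\phi)\to\chi)\to\chi)$, (A7) $\bot\to\phi$, (G4) $\phi\to(\phi\land\phi)$, and the rule modus ponens. $\mathcal{GJ}_0$ has all $\mathcal{L}_J$-instances of the axioms of $\mathcal{G}$, plus (J) $t:(\phi\to\psi)\to(s:\phi\to[t\cdot s]:\psi)$, (+) $t:\phi\to[t+s]:\phi$ and $s:\phi\to[t+s]:\phi$, and modus ponens. Further axiom schemes: (F) $t:\phi\to\phi$;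 (PI) $t:\phi\to\,!t:t:\phi$; (NI) $\neg t:\phi\to\,?t:\neg t:\phi$. A constant specification for a calculus $\mathcal{S}$ is a set $CS$ of formulas $c_n:c_{n-1}:\dots:c_1:\phi$ ($n\ge1$) with $\phi$ an axiom of $\mathcal{S}$ and $c_i$ constants, downward closed (if $c_n:\dots:c_1:\phi\in CS$ then $c_i:\dots:c_1:\phi\in CS$ for $i<n$). $\mathcal{GJ}_{CS}$ is $\mathcal{GJ}_0$ plus the rule: for $c:\psi\in CS$, infer $c:\psi$. $\mathcal{GJT}_{CS}=\mathcal{GJ}_{CS}+(F)$, $\mathcal{GJ}4_{CS}=\mathcal{GJ}_{CS}+(PI)$, $\mathcal{GLP}_{CS}=\mathcal{GJT}_{CS}+(PI)$, $\mathcal{GJ}45_{CS}=\mathcal{GJ}4_{CS}+(NI)$, $\mathcal{GJT}45_{CS}=\mathcal{GJ}45_{CS}+(F)$. $\Gamma\vdash\phi$ denotes derivability from premises $\Gamma$. Models: a Gödel-Justification ($\mathsf{GJ}$) model is $\mathfrak{M}=\langle W,R,\mathcal{E},e\rangle$ with $W\neq\varnothing$, $R:W\times W\to[0,1]$, $\mathcal{E}:Jt\times\mathcal{L}_J\times W\to[0,1]$, $e:W\times Var\to[0,1]$, such that $\mathcal{E}(t,\phi\to\psi,w)\odot\mathcal{E}(s,\phi,w)\le\mathcal{E}(t\cdot s,\psi,w)$ and $\mathcal{E}(t,\phi,w)\oplus\mathcal{E}(s,\phi,w)\le\mathcal{E}(t+s,\phi,w)$ for all $t,s,\phi,\psi,w$.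 $e$ extends to $\mathcal{L}_J$ at each world by $e(w,\bot)=0$, $e(w,\phi\land\psi)=e(w,\phi)\odot e(w,\psi)$, $e(w,\phi\to\psi)=e(w,\phi)\Rightarrow e(w,\psi)$, $e(w,t:\phi)=\mathcal{E}(t,\phi,w)\odot\inf_{v\in W}\{R(w,v)\Rightarrow e(v,\phi)\}$; and $e(w,\Gamma)=\inf_{\psi\in\Gamma}e(w,\psi)$. The model respects $CS$ if $\mathcal{E}(c,\phi,w)=1$ for all $c:\phi\in CS$ and $w\in W$; it is crisp if $R$ takes values in $\{0,1\}$. $\mathsf{GJT}$: reflexive ($R(w,w)=1$) models. $\mathsf{GJ4}$: models with (a) $\mathcal{E}(t,\phi,w)\odot R(w,v)\le\mathcal{E}(t,\phi,v)$, (b) $R(w,v)\odot R(v,u)\le R(w,u)$, (c) $\mathcal{E}(t,\phi,w)\le\mathcal{E}(!t,t:\phi,w)$, for all arguments. $\mathsf{GLP}$: reflexive $\mathsf{GJ4}$-models. $\mathsf{GJ45}$: $\mathsf{GJ4}$-models with $\sim\mathcal{E}(t,\phi,w)\le\mathcal{E}(?t,\neg t:\phi,w)$ and $\mathcal{E}(t,\phi,w)\le e(w,t:\phi)$ for all arguments. $\mathsf{GJT45}$: reflexive $\mathsf{GJ45}$-models. The subscript $\mathsf{CS}$ denotes the subclass of models respecting $CS$. Entailment for a class $\mathsf{C}$: $\Gamma\models_{\mathsf{C}\leq}\phi$ iff for all $\mathfrak{M}\in\mathsf{C}$ and all worlds $w$, $e(w,\Gamma)\le e(w,\phi)$; $\Gamma\models_{\mathsf{C}}\phi$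 iff for all $\mathfrak{M}\in\mathsf{C}$ and all $w$, if $e(w,\psi)=1$ for all $\psi\in\Gamma$ then $e(w,\phi)=1$. *)

theory Defs
  imports Complex_Main
begin

datatype tm =
    TVar nat
  | Const nat
  | App tm tm
  | Plus tm tm
  | Bang tm
  | Query tm

datatype fm =
    Bot
  | Var nat
  | And fm fm  (infixr "\<^bold>\<and>" 64)
  | Imp fm fm  (infixr "\<^bold>\<rightarrow>" 63)
  | Just tm fm  (infixr "\<^bold>:" 66)

abbreviation Neg :: "fm \<Rightarrow> fm" where
  "Neg \<phi> \<equiv> \<phi> \<^bold>\<rightarrow> Bot"


inductive_set G_axioms :: "fm set" where
  A1: "(\<phi> \<^bold>\<rightarrow> \<psi>) \<^bold>\<rightarrow> ((\<psi> \<^bold>\<rightarrow> \<chi>) \<^bold>\<rightarrow> (\<phi> \<^bold>\<rightarrow> \<chi>)) \<in> G_axioms"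
| A2: "(\<phi> \<^bold>\<and> \<psi>) \<^bold>\<rightarrow> \<phi> \<in> G_axioms"
| A3: "(\<phi> \<^bold>\<and> \<psi>) \<^bold>\<rightarrow> (\<psi> \<^bold>\<and> \<phi>) \<in> G_axioms"
| A5a: "(\<phi> \<^bold>\<rightarrow> (\<psi> \<^bold>\<rightarrow> \<chi>)) \<^bold>\<rightarrow> ((\<phi> \<^bold>\<and> \<psi>) \<^bold>\<rightarrow> \<chi>) \<in> G_axioms"
| A5b: "((\<phi> \<^bold>\<and> \<psi>) \<^bold>\<rightarrow> \<chi>) \<^bold>\<rightarrow> (\<phi> \<^bold>\<rightarrow> (\<psi> \<^bold>\<rightarrow> \<chi>)) \<in> G_axioms"
| A6: "((\<phi> \<^bold>\<rightarrow> \<psi>) \<^bold>\<rightarrow> \<chi>) \<^bold>\<rightarrow> (((\<psi> \<^bold>\<rightarrow> \<phi>) \<^bold>\<rightarrow> \<chi>) \<^bold>\<rightarrow> \<chi>) \<in> G_axioms"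
| A7: "Bot \<^bold>\<rightarrow> \<phi> \<in> G_axioms"
| G4: "\<phi> \<^bold>\<rightarrow> (\<phi> \<^bold>\<and> \<phi>) \<in> G_axioms"

inductive_set J_axioms :: "fm set" where
  J: "t \<^bold>: (\<phi> \<^bold>\<rightarrow> \<psi>) \<^bold>\<rightarrow> (s \<^bold>: \<phi> \<^bold>\<rightarrow> App t s \<^bold>: \<psi>) \<in> J_axioms"
| Plus_left: "t \<^bold>: \<phi> \<^bold>\<rightarrow> Plus t s \<^bold>: \<phi> \<in> J_axioms"
| Plus_right: "s \<^bold>: \<phi> \<^bold>\<rightarrow> Plus t s \<^bold>: \<phi> \<in> J_axioms"

definition F_axioms :: "fm set" where
  "F_axioms = {t \<^bold>: \<phi> \<^bold>\<rightarrow> \<phi> | t \<phi>. True}"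

definition PI_axioms :: "fm set" where
  "PI_axioms = {t \<^bold>: \<phi> \<^bold>\<rightarrow> Bang t \<^bold>: t \<^bold>: \<phi> | t \<phi>. True}"

definition NI_axioms :: "fm set" where
  "NI_axioms = {Neg (t \<^bold>: \<phi>) \<^bold>\<rightarrow> Query t \<^bold>: Neg (t \<^bold>: \<phi>) | t \<phi>. True}"

datatype logic = GJ | GJT | GJ4 | GLP | GJ45 | GJT45

primrec axioms_of :: "logic \<Rightarrow> fm set" where
  "axioms_of GJ = G_axioms \<union> J_axioms"
| "axioms_of GJT = G_axioms \<union> J_axioms \<union> F_axioms"
| "axioms_of GJ4 = G_axioms \<union> J_axioms \<union> PI_axioms"
| "axioms_of GLP = G_axioms \<union> J_axioms \<union> F_axioms \<union> PI_axioms"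
| "axioms_of GJ45 = G_axioms \<union> J_axioms \<union> PI_axioms \<union> NI_axioms"
| "axioms_of GJT45 = G_axioms \<union> J_axioms \<union> PI_axioms \<union> NI_axioms \<union> F_axioms"

text \<open>The list \<open>[c\<^sub>n, \<dots>, c\<^sub>1]\<close> and \<open>\<phi>\<close> are sent to \<open>c\<^sub>n : \<dots> : c\<^sub>1 : \<phi>\<close>.\<close>

definition const_chain :: "nat list \<Rightarrow> fm \<Rightarrow> fm" where
  "const_chain cs \<phi> = foldr (\<lambda>c \<psi>. Const c \<^bold>: \<psi>) cs \<phi>"

definition constant_specification :: "logic \<Rightarrow> fm set \<Rightarrow> bool" where
  "constant_specification L CS \<longleftrightarrow>
     (\<forall>\<chi>\<in>CS. \<exists>cs \<phi>. cs \<noteq> [] \<and> \<phi> \<in> axioms_of L \<and> \<chi> = const_chain cs \<phi>) \<and>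
     (\<forall>cs \<phi>. \<forall>k<length cs. \<phi> \<in> axioms_of L \<longrightarrow> const_chain cs \<phi> \<in> CS
        \<longrightarrow> const_chain (drop k cs) \<phi> \<in> CS)"

inductive derives :: "logic \<Rightarrow> fm set \<Rightarrow> fm set \<Rightarrow> fm \<Rightarrow> bool"
  for L :: logic and CS :: "fm set" and \<Gamma> :: "fm set" where
  premise: "\<phi> \<in> \<Gamma> \<Longrightarrow> derives L CS \<Gamma> \<phi>"
| axiom: "\<phi> \<in> axioms_of L \<Longrightarrow> derives L CS \<Gamma> \<phi>"
| const: "Const c \<^bold>: \<psi> \<in> CS \<Longrightarrow> derives L CS \<Gamma> (Const c \<^bold>: \<psi>)"
| mp: "derives L CS \<Gamma> (\<phi> \<^bold>\<rightarrow> \<psi>) \<Longrightarrow> derives L CS \<Gamma> \<phi> \<Longrightarrow> derives L CS \<Gamma> \<psi>"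


definition gimp :: "real \<Rightarrow> real \<Rightarrow> real" where
  "gimp x y = (if x \<le> y then 1 else y)"

definition gneg :: "real \<Rightarrow> real" where
  "gneg x = (if x = 0 then 1 else 0)"

text \<open>Infimum in the complete lattice \<open>[0,1]\<close>: unlike in \<open>\<real>\<close>, that of the empty set is \<open>1\<close>.\<close>

definition Inf01 :: "real set \<Rightarrow> real" where
  "Inf01 A = (if A = {} then 1 else Inf A)"

text \<open>The world set is a nonempty carrier \<open>W\<close> in an arbitrary type; the structure is constrained
  on \<open>W\<close> only. \<open>V\<close> is the assignment to variables, extended to all formulas by \<open>eval\<close>.\<close>

record 'w model =
  W :: "'w set"
  R :: "'w \<Rightarrow> 'w \<Rightarrow> real"
  E :: "tm \<Rightarrow> fm \<Rightarrow> 'w \<Rightarrow> real"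
  V :: "'w \<Rightarrow> nat \<Rightarrow> real"

primrec eval :: "'w model \<Rightarrow> 'w \<Rightarrow> fm \<Rightarrow> real" where
  "eval M w Bot = 0"
| "eval M w (Var p) = V M w p"
| "eval M w (\<phi> \<^bold>\<and> \<psi>) = min (eval M w \<phi>) (eval M w \<psi>)"
| "eval M w (\<phi> \<^bold>\<rightarrow> \<psi>) = gimp (eval M w \<phi>) (eval M w \<psi>)"
| "eval M w (t \<^bold>: \<phi>) =
     min (E M t \<phi> w) (Inf01 ((\<lambda>v. gimp (R M w v) (eval M v \<phi>)) ` W M))"

definition eval_set :: "'w model \<Rightarrow> 'w \<Rightarrow> fm set \<Rightarrow> real" where
  "eval_set M w \<Gamma> = Inf01 (eval M w ` \<Gamma>)"

definition GJ_model :: "'w model \<Rightarrow> bool" where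
  "GJ_model M \<longleftrightarrow>
     W M \<noteq> {} \<and>
     (\<forall>w\<in>W M. \<forall>v\<in>W M. R M w v \<in> {0..1}) \<and>
     (\<forall>t \<phi>. \<forall>w\<in>W M. E M t \<phi> w \<in> {0..1}) \<and>
     (\<forall>w\<in>W M. \<forall>p. V M w p \<in> {0..1}) \<and>
     (\<forall>t s \<phi> \<psi>. \<forall>w\<in>W M. min (E M t (\<phi> \<^bold>\<rightarrow> \<psi>) w) (E M s \<phi> w) \<le> E M (App t s) \<psi> w) \<and>
     (\<forall>t s \<phi>. \<forall>w\<in>W M. max (E M t \<phi> w) (E M s \<phi> w) \<le> E M (Plus t s) \<phi> w)"

definition reflexive_model :: "'w model \<Rightarrow> bool" where
  "reflexive_model M \<longleftrightarrow> (\<forall>w\<in>W M. R M w w = 1)"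

definition crisp_model :: "'w model \<Rightarrow> bool" where
  "crisp_model M \<longleftrightarrow> (\<forall>w\<in>W M. \<forall>v\<in>W M. R M w v \<in> {0, 1})"

definition GJ4_model :: "'w model \<Rightarrow> bool" where
  "GJ4_model M \<longleftrightarrow> GJ_model M \<and>
     (\<forall>t \<phi>. \<forall>w\<in>W M. \<forall>v\<in>W M. min (E M t \<phi> w) (R M w v) \<le> E M t \<phi> v) \<and>
     (\<forall>w\<in>W M. \<forall>v\<in>W M. \<forall>u\<in>W M. min (R M w v) (R M v u) \<le> R M w u) \<and>
     (\<forall>t \<phi>. \<forall>w\<in>W M. E M t \<phi> w \<le> E M (Bang t) (t \<^bold>: \<phi>) w)"

definition GJ45_model :: "'w model \<Rightarrow> bool" where
  "GJ45_model M \<longleftrightarrow> GJ4_model M \<and>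
     (\<forall>t \<phi>. \<forall>w\<in>W M. gneg (E M t \<phi> w) \<le> E M (Query t) (Neg (t \<^bold>: \<phi>)) w) \<and>
     (\<forall>t \<phi>. \<forall>w\<in>W M. E M t \<phi> w \<le> eval M w (t \<^bold>: \<phi>))"

definition respects_CS :: "'w model \<Rightarrow> fm set \<Rightarrow> bool" where
  "respects_CS M CS \<longleftrightarrow> (\<forall>c \<phi>. Const c \<^bold>: \<phi> \<in> CS \<longrightarrow> (\<forall>w\<in>W M. E M (Const c) \<phi> w = 1))"

primrec model_of :: "logic \<Rightarrow> 'w model \<Rightarrow> bool" where
  "model_of GJ M = GJ_model M"
| "model_of GJT M = (GJ_model M \<and> reflexive_model M)"
| "model_of GJ4 M = GJ4_model M"
| "model_of GLP M = (GJ4_model M \<and> reflexive_model M)"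
| "model_of GJ45 M = GJ45_model M"
| "model_of GJT45 M = (GJ45_model M \<and> reflexive_model M)"

definition models :: "logic \<Rightarrow> fm set \<Rightarrow> 'w model set" where
  "models L CS = {M. model_of L M \<and> respects_CS M CS}"

definition crisp_models :: "logic \<Rightarrow> fm set \<Rightarrow> 'w model set" where
  "crisp_models L CS = {M \<in> models L CS. crisp_model M}"

definition entails_le :: "'w model set \<Rightarrow> fm set \<Rightarrow> fm \<Rightarrow> bool" where
  "entails_le C \<Gamma> \<phi> \<longleftrightarrow> (\<forall>M\<in>C. \<forall>w\<in>W M. eval_set M w \<Gamma> \<le> eval M w \<phi>)"

definition entails :: "'w model set \<Rightarrow> fm set \<Rightarrow> fm \<Rightarrow> bool" where
  "entails C \<Gamma> \<phi> \<longleftrightarrow>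
     (\<forall>M\<in>C. \<forall>w\<in>W M. (\<forall>\<psi>\<in>\<Gamma>. eval M w \<psi> = 1) \<longrightarrow> eval M w \<phi> = 1)"

end

theory Submission
  imports Defs "HOL-Library.Countable"
begin

text \<open>
  Soundness is residuation in \<open>[0,1]\<close>. For completeness, a theory that is maximal among those
  extending \<open>\<Gamma>\<close> and not proving \<open>\<phi>\<close> is linearly preordered by provable implication, by (A6).
  The Lindenbaum preorder is countable, hence embeds into \<open>[0,1]\<close> preserving the endpoints,
  and Goedel connectives are determined by the order; so there is a \<open>[0,1]\<close>-valuation \<open>v\<close>, treating
  \<open>t : \<psi>\<close> as atoms, with value \<open>1\<close> exactly on the theory. One world is then enough: put
  \<open>\<E>(t,\<psi>) = v(t : \<psi>)\<close>, and let the world see itself if (F) is an axiom, and nothing otherwise.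
  The modal part of the value of \<open>t : \<psi>\<close> is then \<open>v(\<psi>)\<close>, redundant by (F), or \<open>1\<close>.
\<close>

section \<open>Soundness\<close>

text \<open>Residuation: \<open>gimp\<close> is the right adjoint of \<open>min\<close>. The bound
  on \<open>x\<close> matters because \<open>gimp\<close> never exceeds 1.\<close>

lemma le_gimp_iff: "x \<le> 1 \<Longrightarrow> x \<le> gimp y z \<longleftrightarrow> min x y \<le> z"
  by (auto simp: gimp_def min_def)

lemma gimp_eq_1_iff: "y \<le> 1 \<Longrightarrow> z \<le> 1 \<Longrightarrow> gimp y z = 1 \<longleftrightarrow> y \<le> z"
  by (auto simp: gimp_def)

lemma gimp_in_unit: "y \<in> {0..1} \<Longrightarrow> gimp x y \<in> {0..1}"
  by (auto simp: gimp_def)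

text \<open>The bound \<open>x \<le> 1\<close> takes care of the empty set, whose infimum is 1;
  nonnegativity supplies the lower bound that the conditionally complete reals ask for.\<close>

lemma le_Inf01_iff:
  assumes "\<And>a. a \<in> A \<Longrightarrow> 0 \<le> a" "x \<le> 1"
  shows "x \<le> Inf01 A \<longleftrightarrow> (\<forall>a\<in>A. x \<le> a)"
proof (cases "A = {}")
  case False
  have "bdd_below A"
    using assms(1) by (rule bdd_belowI)
  then show ?thesis
    using False by (simp add: Inf01_def le_cInf_iff)
qed (use assms in \<open>simp add: Inf01_def\<close>)

lemma Inf01_in_unit:
  assumes "A \<subseteq> {0..1}"
  shows "Inf01 A \<in> {0..1}"
proof (cases "A = {}")
  case False
  then obtain a where "a \<in> A"
    by blast
  moreover have "bdd_below A"
    using assms by (intro bdd_belowI[of _ 0]) auto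
  ultimately have "Inf A \<le> 1"
    using assms by (meson atLeastAtMost_iff cInf_lower order_trans subsetD)
  moreover have "0 \<le> Inf A"
    using False assms by (intro cInf_greatest) auto
  ultimately show ?thesis
    using False by (simp add: Inf01_def)
qed (simp add: Inf01_def)

lemma eval_in_unit:
  assumes "GJ_model M" "w \<in> W M"
  shows "eval M w \<phi> \<in> {0..1}"
  using assms(2)
proof (induction \<phi> arbitrary: w)
  case (Var p)
  then show ?case using assms(1) by (simp add: GJ_model_def)
next
  case (Just t \<phi>)
  have "Inf01 ((\<lambda>v. gimp (R M w v) (eval M v \<phi>)) ` W M) \<in> {0..1}"
    using Just.IH by (intro Inf01_in_unit) (auto intro: gimp_in_unit simp del: atLeastAtMost_iff)
  moreover have "E M t \<phi> w \<in> {0..1}"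
    using assms(1) Just.prems by (simp add: GJ_model_def)
  ultimately show ?case by (auto simp: min_def)
qed (auto simp: gimp_def min_def)

text \<open>The universal property of the infimum combined with residuation. It reduces lower bounds
  on justification formulas to worldwise inequalities, so that no infimum occurs in the validity
  proofs.\<close>

lemma le_eval_Just_iff:
  assumes "GJ_model M" "w \<in> W M" "x \<le> 1"
  shows "x \<le> eval M w (t \<^bold>: \<phi>) \<longleftrightarrow>
    x \<le> E M t \<phi> w \<and> (\<forall>v\<in>W M. min x (R M w v) \<le> eval M v \<phi>)"
proof -
  have "0 \<le> gimp (R M w v) (eval M v \<phi>)" if "v \<in> W M" for v
    using gimp_in_unit[OF eval_in_unit[OF assms(1) that]] by simp
  then have "x \<le> Inf01 ((\<lambda>v. gimp (R M w v) (eval M v \<phi>)) ` W M) \<longleftrightarrow>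
      (\<forall>v\<in>W M. x \<le> gimp (R M w v) (eval M v \<phi>))"
    using assms(3) by (subst le_Inf01_iff) auto
  then show ?thesis
    using assms(3) by (simp add: le_gimp_iff)
qed

lemma eval_Imp_eq_1_iff:
  assumes "GJ_model M" "w \<in> W M"
  shows "eval M w (\<phi> \<^bold>\<rightarrow> \<psi>) = 1 \<longleftrightarrow> eval M w \<phi> \<le> eval M w \<psi>"
  using eval_in_unit[OF assms, of \<phi>] eval_in_unit[OF assms, of \<psi>] by (simp add: gimp_eq_1_iff)

text \<open>The preceding equivalence with \<open>x\<close> taken to be the value itself.\<close>

lemma eval_Just_le:
  assumes "GJ_model M" "w \<in> W M"
  shows "eval M w (t \<^bold>: \<phi>) \<le> E M t \<phi> w"
    and "v \<in> W M \<Longrightarrow> min (eval M w (t \<^bold>: \<phi>)) (R M w v) \<le> eval M v \<phi>"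
proof -
  have "eval M w (t \<^bold>: \<phi>) \<le> 1"
    using eval_in_unit[OF assms, of "t \<^bold>: \<phi>"] by simp
  then show "eval M w (t \<^bold>: \<phi>) \<le> E M t \<phi> w"
    and "v \<in> W M \<Longrightarrow> min (eval M w (t \<^bold>: \<phi>)) (R M w v) \<le> eval M v \<phi>"
    using le_eval_Just_iff[OF assms, of "eval M w (t \<^bold>: \<phi>)" t \<phi>] by blast+
qed

section \<open>Validity of the axioms\<close>

lemma G_axioms_valid:
  assumes "GJ_model M" "w \<in> W M" "\<phi> \<in> G_axioms"
  shows "eval M w \<phi> = 1"
proof -
  have b: "0 \<le> eval M w \<psi>" "eval M w \<psi> \<le> 1" for \<psi>
    using eval_in_unit[OF assms(1,2), of \<psi>] by auto
  show ?thesis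
    using assms(3)
  proof cases
    case (A1 \<phi> \<psi> \<chi>)
    show ?thesis unfolding A1 using b[of \<phi>] b[of \<psi>] b[of \<chi>] by (auto simp: gimp_def)
  next
    case (A2 \<phi> \<psi>)
    show ?thesis unfolding A2 using b[of \<phi>] b[of \<psi>] by (auto simp: gimp_def)
  next
    case (A3 \<phi> \<psi>)
    show ?thesis unfolding A3 using b[of \<phi>] b[of \<psi>] by (auto simp: gimp_def)
  next
    case (A5a \<phi> \<psi> \<chi>)
    show ?thesis unfolding A5a using b[of \<phi>] b[of \<psi>] b[of \<chi>] by (auto simp: gimp_def min_def)
  next
    case (A5b \<phi> \<psi> \<chi>)
    show ?thesis unfolding A5b using b[of \<phi>] b[of \<psi>] b[of \<chi>] by (auto simp: gimp_def min_def)
  next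
    case (A6 \<phi> \<psi> \<chi>)
    show ?thesis unfolding A6 using b[of \<phi>] b[of \<psi>] b[of \<chi>] by (auto simp: gimp_def)
  next
    case (A7 \<phi>)
    show ?thesis unfolding A7 using b[of \<phi>] by (auto simp: gimp_def)
  next
    case (G4 \<phi>)
    show ?thesis unfolding G4 using b[of \<phi>] by (auto simp: gimp_def)
  qed
qed

text \<open>For (J), residuation leaves a bound on the meet \<open>x\<close> of the two antecedents:
  closure of evidence under application bounds the evidence part, and modus ponens at each world
  bounds the modal part.\<close>

lemma J_axioms_valid:
  assumes M: "GJ_model M" and w: "w \<in> W M" and "\<phi> \<in> J_axioms"
  shows "eval M w \<phi> = 1"
  using assms(3)
proof cases
  case (J t \<phi> \<psi> s)
  define x where "x = min (eval M w (t \<^bold>: (\<phi> \<^bold>\<rightarrow> \<psi>))) (eval M w (s \<^bold>: \<phi>))"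
  have u: "eval M v \<chi> \<le> 1" if "v \<in> W M" for v \<chi>
    using eval_in_unit[OF M that, of \<chi>] by simp
  have x1: "x \<le> 1"
    using u[OF w] unfolding x_def by (meson min.coboundedI1)
  have "x \<le> E M t (\<phi> \<^bold>\<rightarrow> \<psi>) w" "x \<le> E M s \<phi> w"
    unfolding x_def using eval_Just_le(1)[OF M w] by (meson min.coboundedI1 min.coboundedI2)+
  moreover have "min (E M t (\<phi> \<^bold>\<rightarrow> \<psi>) w) (E M s \<phi> w) \<le> E M (App t s) \<psi> w"
    using M w by (simp add: GJ_model_def)
  ultimately have "x \<le> E M (App t s) \<psi> w"
    by linarith
  moreover have "min x (R M w v) \<le> eval M v \<psi>" if v: "v \<in> W M" for v
  proof -
    let ?y = "min x (R M w v)"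
    have "?y \<le> min (eval M w (t \<^bold>: (\<phi> \<^bold>\<rightarrow> \<psi>))) (R M w v)" "?y \<le> min (eval M w (s \<^bold>: \<phi>)) (R M w v)"
      by (auto simp: x_def simp del: eval.simps)
    then have "?y \<le> eval M v (\<phi> \<^bold>\<rightarrow> \<psi>)" and y: "?y \<le> eval M v \<phi>"
      using eval_Just_le(2)[OF M w v] order_trans by blast+
    \<comment> \<open>Residuation at \<open>v\<close>: \<open>?y\<close> lies below an implication
      and below its antecedent, hence below its conclusion.\<close>
    then have "min ?y (eval M v \<phi>) \<le> eval M v \<psi>"
      using x1 by (subst le_gimp_iff[symmetric]) auto
    then show ?thesis using y by linarith
  qed
  ultimately have "x \<le> eval M w (App t s \<^bold>: \<psi>)"
    using le_eval_Just_iff[OF M w x1] by blast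
  then have "eval M w (t \<^bold>: (\<phi> \<^bold>\<rightarrow> \<psi>)) \<le> eval M w (s \<^bold>: \<phi> \<^bold>\<rightarrow> App t s \<^bold>: \<psi>)"
    using u[OF w, of "t \<^bold>: (\<phi> \<^bold>\<rightarrow> \<psi>)"] by (simp add: le_gimp_iff x_def del: eval.simps(5))
  then show ?thesis
    unfolding J using eval_Imp_eq_1_iff[OF M w] by blast
next
  case (Plus_left t \<phi> s)
  have "E M t \<phi> w \<le> E M (Plus t s) \<phi> w"
    using M w by (simp add: GJ_model_def)
  then have "eval M w (t \<^bold>: \<phi>) \<le> eval M w (Plus t s \<^bold>: \<phi>)"
    by auto
  then show ?thesis
    unfolding Plus_left using eval_Imp_eq_1_iff[OF M w] by blast
next
  case (Plus_right s \<phi> t)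
  have "E M s \<phi> w \<le> E M (Plus t s) \<phi> w"
    using M w by (simp add: GJ_model_def)
  then have "eval M w (s \<^bold>: \<phi>) \<le> eval M w (Plus t s \<^bold>: \<phi>)"
    by auto
  then show ?thesis
    unfolding Plus_right using eval_Imp_eq_1_iff[OF M w] by blast
qed

text \<open>The modal bound taken at \<open>v = w\<close>, where accessibility 1 truncates
  nothing.\<close>

lemma F_axioms_valid:
  assumes M: "GJ_model M" and "reflexive_model M" and w: "w \<in> W M" and "\<phi> \<in> F_axioms"
  shows "eval M w \<phi> = 1"
proof -
  obtain t \<psi> where \<phi>: "\<phi> = t \<^bold>: \<psi> \<^bold>\<rightarrow> \<psi>"
    using assms(4) by (auto simp: F_axioms_def)
  have "R M w w = 1"
    using assms(2) w by (simp add: reflexive_model_def)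
  moreover have "eval M w (t \<^bold>: \<psi>) \<le> 1"
    using eval_in_unit[OF M w, of "t \<^bold>: \<psi>"] by simp
  ultimately have "eval M w (t \<^bold>: \<psi>) \<le> eval M w \<psi>"
    using eval_Just_le(2)[OF M w w, of t \<psi>] by linarith
  then show ?thesis
    unfolding \<phi> using eval_Imp_eq_1_iff[OF M w] by blast
qed

text \<open>Evidence is monotone along \<open>R\<close>, and transitivity carries the modal bound
  over two steps, so \<open>t : \<psi>\<close> keeps its value, truncated by \<open>R\<close>, at
  accessible worlds.\<close>

lemma PI_axioms_valid:
  assumes M4: "GJ4_model M" and w: "w \<in> W M" and "\<phi> \<in> PI_axioms"
  shows "eval M w \<phi> = 1"
proof -
  obtain t \<psi> where \<phi>: "\<phi> = t \<^bold>: \<psi> \<^bold>\<rightarrow> Bang t \<^bold>: t \<^bold>: \<psi>"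
    using assms(3) by (auto simp: PI_axioms_def)
  have M: "GJ_model M"
    using M4 by (simp add: GJ4_model_def)
  define x where "x = eval M w (t \<^bold>: \<psi>)"
  have x1: "x \<le> 1"
    using eval_in_unit[OF M w, of "t \<^bold>: \<psi>"] by (simp add: x_def)
  have xE: "x \<le> E M t \<psi> w"
    unfolding x_def by (rule eval_Just_le(1)[OF M w])
  also have "\<dots> \<le> E M (Bang t) (t \<^bold>: \<psi>) w"
    using M4 w by (simp add: GJ4_model_def)
  finally have "x \<le> E M (Bang t) (t \<^bold>: \<psi>) w" .
  moreover have "min x (R M w v) \<le> eval M v (t \<^bold>: \<psi>)" if v: "v \<in> W M" for v
  proof -
    have "min (E M t \<psi> w) (R M w v) \<le> E M t \<psi> v"
      using M4 w v by (simp add: GJ4_model_def)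
    then have "min x (R M w v) \<le> E M t \<psi> v"
      using xE by linarith
    moreover have "min (min x (R M w v)) (R M v u) \<le> eval M u \<psi>" if u: "u \<in> W M" for u
    proof -
      have "min (R M w v) (R M v u) \<le> R M w u"
        using M4 w v u by (simp add: GJ4_model_def)
      then show ?thesis
        using eval_Just_le(2)[OF M w u, of t \<psi>] unfolding x_def by linarith
    qed
    ultimately show ?thesis
      using le_eval_Just_iff[OF M v, of "min x (R M w v)"] x1 by (meson min.coboundedI1)
  qed
  ultimately have "x \<le> eval M w (Bang t \<^bold>: t \<^bold>: \<psi>)"
    using le_eval_Just_iff[OF M w x1] by blast
  then show ?thesis
    unfolding \<phi> x_def using eval_Imp_eq_1_iff[OF M w] by blast
qed

text \<open>Strong evidence, \<open>E \<le> eval\<close>, is used twice: under the antitone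
  \<open>gneg\<close>, and for the term \<open>Query t\<close>. This bypasses any argument about
  accessible worlds.\<close>

lemma NI_axioms_valid:
  assumes M45: "GJ45_model M" and w: "w \<in> W M" and "\<phi> \<in> NI_axioms"
  shows "eval M w \<phi> = 1"
proof -
  obtain t \<psi> where \<phi>: "\<phi> = Neg (t \<^bold>: \<psi>) \<^bold>\<rightarrow> Query t \<^bold>: Neg (t \<^bold>: \<psi>)"
    using assms(3) by (auto simp: NI_axioms_def)
  have M: "GJ_model M"
    using M45 by (simp add: GJ45_model_def GJ4_model_def)
  have le: "E M s \<chi> w \<le> eval M w (s \<^bold>: \<chi>)" for s \<chi>
    using M45 w unfolding GJ45_model_def by blast
  have u: "0 \<le> eval M w \<chi>" for \<chi>
    using eval_in_unit[OF M w, of \<chi>] by simp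
  have "eval M w (Neg (t \<^bold>: \<psi>)) = gneg (eval M w (t \<^bold>: \<psi>))"
    using u[of "t \<^bold>: \<psi>"] by (simp add: gneg_def gimp_def del: eval.simps(5))
  also have "\<dots> \<le> gneg (E M t \<psi> w)"
  proof -
    have "0 \<le> E M t \<psi> w"
      using M w by (simp add: GJ_model_def)
    then show ?thesis using le[of t \<psi>] by (simp add: gneg_def del: eval.simps(5))
  qed
  also have "\<dots> \<le> E M (Query t) (Neg (t \<^bold>: \<psi>)) w"
    using M45 w by (simp add: GJ45_model_def)
  also have "\<dots> \<le> eval M w (Query t \<^bold>: Neg (t \<^bold>: \<psi>))"
    by (rule le)
  finally show ?thesis
    unfolding \<phi> using eval_Imp_eq_1_iff[OF M w] by blast
qed

lemma model_of_imp_GJ_model: "model_of L M \<Longrightarrow> GJ_model M"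
  by (cases L) (auto simp: GJ45_model_def GJ4_model_def)

lemma axioms_of_valid:
  assumes "model_of L M" "w \<in> W M" "\<phi> \<in> axioms_of L"
  shows "eval M w \<phi> = 1"
proof -
  note M = model_of_imp_GJ_model[OF assms(1)]
  have 4: "GJ45_model M \<Longrightarrow> GJ4_model M"
    by (simp add: GJ45_model_def)
  note v = G_axioms_valid[OF M assms(2)] J_axioms_valid[OF M assms(2)]
    F_axioms_valid[OF M _ assms(2)] PI_axioms_valid[OF _ assms(2)] NI_axioms_valid[OF _ assms(2)]
  show ?thesis
    using assms(1,3) by (cases L) (auto intro: v dest: 4)
qed

section \<open>Constant specifications and soundness\<close>

text \<open>Respecting \<open>CS\<close> fixes only the evidence part. The modal part needs the
  formula below the outermost constant to be true at all worlds, which downward closure yields by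
  induction along the chain.\<close>

lemma constant_specification_valid:
  assumes "constant_specification L CS" "M \<in> models L CS" "w \<in> W M" "\<chi> \<in> CS"
  shows "eval M w \<chi> = 1"
proof -
  have mo: "model_of L M" and re: "respects_CS M CS"
    using assms(2) by (auto simp: models_def)
  note M = model_of_imp_GJ_model[OF mo]
  \<comment> \<open>Membership in \<open>CS\<close> is asked of nonempty chains only, so that the
    induction can start at the bare axiom. The world is general because the step uses every
    world.\<close>
  have "eval M w (const_chain cs \<phi>) = 1"
    if "\<phi> \<in> axioms_of L" "cs \<noteq> [] \<Longrightarrow> const_chain cs \<phi> \<in> CS" "w \<in> W M" for cs \<phi> w
    using that
  proof (induction cs arbitrary: w)
    case Nil
    then show ?case using axioms_of_valid[OF mo] by (simp add: const_chain_def)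
  next
    case (Cons c cs)
    let ?\<psi> = "const_chain cs \<phi>"
    have c: "const_chain (c # cs) \<phi> = Const c \<^bold>: ?\<psi>"
      by (simp add: const_chain_def)
    have "?\<psi> \<in> CS" if "cs \<noteq> []"
    proof -
      have "const_chain (drop 1 (c # cs)) \<phi> \<in> CS"
        using assms(1) Cons.prems that unfolding constant_specification_def
        by (metis length_Cons length_greater_0_conv list.distinct(1) One_nat_def Suc_less_eq)
      then show ?thesis by simp
    qed
    then have "eval M v ?\<psi> = 1" if "v \<in> W M" for v
      using Cons.IH Cons.prems(1) that by blast
    moreover have "E M (Const c) ?\<psi> w = 1"
      using re Cons.prems(2,3) c by (simp add: respects_CS_def)
    ultimately have "1 \<le> eval M w (Const c \<^bold>: ?\<psi>)"
      using le_eval_Just_iff[OF M Cons.prems(3), of 1] by (simp del: eval.simps)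
    then show ?case
      using eval_in_unit[OF M Cons.prems(3), of "Const c \<^bold>: ?\<psi>"] unfolding c by (simp del: eval.simps)
  qed
  then show ?thesis
    using assms(1,3,4) unfolding constant_specification_def by metis
qed

text \<open>The value of \<open>\<Gamma>\<close> at \<open>w\<close> is a lower bound for everything
  derivable: axioms and \<open>CS\<close> formulas have value 1, and modus ponens preserves lower
  bounds by residuation.\<close>

theorem soundness:
  assumes "constant_specification L CS" "derives L CS \<Gamma> \<phi>"
  shows "entails_le (models L CS :: 'w model set) \<Gamma> \<phi>"
  unfolding entails_le_def
proof (intro ballI)
  fix M :: "'w model" and w
  assume mo: "M \<in> models L CS" and w: "w \<in> W M"
  then have mo': "model_of L M"
    by (simp add: models_def)
  note M = model_of_imp_GJ_model[OF mo']
  note u = eval_in_unit[OF M w]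
  have s1: "eval_set M w \<Gamma> \<le> 1"
    using Inf01_in_unit[of "eval M w ` \<Gamma>"] u unfolding eval_set_def by fastforce
  show "eval_set M w \<Gamma> \<le> eval M w \<phi>"
    using assms(2)
  proof induction
    case (premise \<phi>)
    have "\<forall>a\<in>eval M w ` \<Gamma>. eval_set M w \<Gamma> \<le> a"
      using u s1 unfolding eval_set_def by (subst le_Inf01_iff[symmetric]) auto
    then show ?case using premise by blast
  next
    case (axiom \<phi>)
    then show ?case using axioms_of_valid[OF mo' w] s1 by simp
  next
    case (const c \<psi>)
    then show ?case using constant_specification_valid[OF assms(1) mo w] s1 by metis
  next
    case (mp \<phi> \<psi>)
    then show ?case using s1 by (simp add: le_gimp_iff)
  qed
qed

lemma entails_le_imp_entails:
  assumes "entails_le (models L CS :: 'w model set) \<Gamma> \<phi>"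
  shows "entails (models L CS :: 'w model set) \<Gamma> \<phi>"
  unfolding entails_def
proof (intro ballI impI)
  fix M :: "'w model" and w
  assume mo: "M \<in> models L CS" and w: "w \<in> W M" and 1: "\<forall>\<psi>\<in>\<Gamma>. eval M w \<psi> = 1"
  have M: "GJ_model M"
    using mo model_of_imp_GJ_model by (auto simp: models_def)
  have "1 \<le> eval_set M w \<Gamma>"
    unfolding eval_set_def using 1 by (subst le_Inf01_iff) auto
  also have "\<dots> \<le> eval M w \<phi>"
    using assms mo w by (simp add: entails_le_def)
  finally show "eval M w \<phi> = 1"
    using eval_in_unit[OF M w, of \<phi>] by simp
qed

section \<open>Derivability\<close>

lemma GJ_axioms_subset: "G_axioms \<union> J_axioms \<subseteq> axioms_of L"
  by (cases L) auto

lemma derives_G: "\<phi> \<in> G_axioms \<Longrightarrow> derives L CS \<Gamma> \<phi>"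
  using GJ_axioms_subset by (blast intro: derives.axiom)

lemma derives_trans:
  "derives L CS \<Gamma> (\<phi> \<^bold>\<rightarrow> \<psi>) \<Longrightarrow> derives L CS \<Gamma> (\<psi> \<^bold>\<rightarrow> \<chi>) \<Longrightarrow> derives L CS \<Gamma> (\<phi> \<^bold>\<rightarrow> \<chi>)"
  by (meson derives.mp derives_G A1)

lemma derives_uncurry:
  "derives L CS \<Gamma> (\<phi> \<^bold>\<rightarrow> \<psi> \<^bold>\<rightarrow> \<chi>) \<Longrightarrow> derives L CS \<Gamma> (\<phi> \<^bold>\<and> \<psi> \<^bold>\<rightarrow> \<chi>)"
  by (meson derives.mp derives_G A5a)

lemma derives_curry:
  "derives L CS \<Gamma> (\<phi> \<^bold>\<and> \<psi> \<^bold>\<rightarrow> \<chi>) \<Longrightarrow> derives L CS \<Gamma> (\<phi> \<^bold>\<rightarrow> \<psi> \<^bold>\<rightarrow> \<chi>)"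
  by (meson derives.mp derives_G A5b)

lemma derives_K: "derives L CS \<Gamma> (\<phi> \<^bold>\<rightarrow> \<psi> \<^bold>\<rightarrow> \<phi>)"
  by (intro derives_curry derives_G A2)

lemma derives_weaken: "derives L CS \<Gamma> \<phi> \<Longrightarrow> derives L CS \<Gamma> (\<psi> \<^bold>\<rightarrow> \<phi>)"
  by (rule derives.mp[OF derives_K])

lemma derives_refl: "derives L CS \<Gamma> (\<phi> \<^bold>\<rightarrow> \<phi>)"
  by (meson derives_trans derives_G G4 A2)

lemma derives_swap:
  "derives L CS \<Gamma> (\<phi> \<^bold>\<rightarrow> \<psi> \<^bold>\<rightarrow> \<chi>) \<Longrightarrow> derives L CS \<Gamma> (\<psi> \<^bold>\<rightarrow> \<phi> \<^bold>\<rightarrow> \<chi>)"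
  by (meson derives_trans derives_curry derives_uncurry derives_G A3)

text \<open>Idempotence of conjunction, (G4), gives contraction; through \<open>derives_S\<close> it
  makes the deduction theorem hold without counting uses of a premise.\<close>

lemma derives_contract:
  "derives L CS \<Gamma> (\<phi> \<^bold>\<rightarrow> \<phi> \<^bold>\<rightarrow> \<psi>) \<Longrightarrow> derives L CS \<Gamma> (\<phi> \<^bold>\<rightarrow> \<psi>)"
  by (meson derives_trans derives_uncurry derives_G G4)

lemma derives_S:
  "derives L CS \<Gamma> (\<phi> \<^bold>\<rightarrow> \<psi> \<^bold>\<rightarrow> \<chi>) \<Longrightarrow> derives L CS \<Gamma> (\<phi> \<^bold>\<rightarrow> \<psi>) \<Longrightarrow> derives L CS \<Gamma> (\<phi> \<^bold>\<rightarrow> \<chi>)"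
  by (meson derives_contract derives_swap derives_trans)

lemma derives_And_intro:
  assumes "derives L CS \<Gamma> (\<chi> \<^bold>\<rightarrow> \<phi>)" "derives L CS \<Gamma> (\<chi> \<^bold>\<rightarrow> \<psi>)"
  shows "derives L CS \<Gamma> (\<chi> \<^bold>\<rightarrow> \<phi> \<^bold>\<and> \<psi>)"
  using assms by (meson derives_S derives_trans derives_curry derives_refl)

section \<open>Deduction theorem and linear theories\<close>

text \<open>Modus ponens is the only rule acting on derived formulas, and \<open>derives_S\<close>
  handles it; \<open>CS\<close> formulas come without premises and are merely weakened.\<close>

lemma deduction_theorem:
  assumes "derives L CS (insert \<phi> \<Gamma>) \<psi>"
  shows "derives L CS \<Gamma> (\<phi> \<^bold>\<rightarrow> \<psi>)"
  using assms
proof induction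
  case (premise \<psi>)
  then show ?case
    using derives_refl derives_weaken derives.premise by blast
next
  case (mp \<psi> \<chi>)
  then show ?case using derives_S by blast
qed (blast intro: derives_weaken derives.intros)+

lemma derives_mono: "derives L CS \<Gamma> \<phi> \<Longrightarrow> \<Gamma> \<subseteq> \<Delta> \<Longrightarrow> derives L CS \<Delta> \<phi>"
  by (induction rule: derives.induct) (blast intro: derives.intros)+

text \<open>Only modus ponens combines two members of the chain, and the larger of them derives both
  premises.\<close>

lemma derives_Union_chain:
  assumes "subset.chain \<A> \<C>" "\<C> \<noteq> {}" "derives L CS (\<Union>\<C>) \<phi>"
  shows "\<exists>T\<in>\<C>. derives L CS T \<phi>"
  using assms(3)
proof induction
  case (mp \<phi> \<psi>)
  then obtain S T where "S \<in> \<C>" "T \<in> \<C>" "derives L CS S (\<phi> \<^bold>\<rightarrow> \<psi>)" "derives L CS T \<phi>"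
    by blast
  moreover have "S \<subseteq> T \<or> T \<subseteq> S"
    using assms(1) \<open>S \<in> \<C>\<close> \<open>T \<in> \<C>\<close> by (auto simp: subset_chain_def)
  ultimately show ?case
    by (meson derives.mp derives_mono)
qed (use assms(2) in \<open>blast intro: derives.intros\<close>)+

text \<open>Zorn's lemma gives a maximal \<open>T\<close>. If it derived neither implication, each
  of them would imply \<open>\<phi>\<close> over \<open>T\<close>, and (A6) would then yield
  \<open>\<phi>\<close>.\<close>

lemma linear_theory_exists:
  assumes "\<not> derives L CS \<Gamma> \<phi>"
  obtains T where "\<Gamma> \<subseteq> T" "\<not> derives L CS T \<phi>"
    "\<And>\<alpha> \<beta>. derives L CS T (\<alpha> \<^bold>\<rightarrow> \<beta>) \<or> derives L CS T (\<beta> \<^bold>\<rightarrow> \<alpha>)"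
proof -
  let ?\<A> = "{T. \<Gamma> \<subseteq> T \<and> \<not> derives L CS T \<phi>}"
  have "\<exists>T\<in>?\<A>. \<forall>S\<in>?\<A>. T \<subseteq> S \<longrightarrow> S = T"
  proof (rule subset_Zorn_nonempty)
    fix \<C>
    assume C: "\<C> \<noteq> {}" "subset.chain ?\<A> \<C>"
    then have "\<C> \<subseteq> ?\<A>"
      by (simp add: subset_chain_def)
    then show "\<Union>\<C> \<in> ?\<A>"
      using C derives_Union_chain[OF C(2,1)] by blast
  qed (use assms in blast)
  then obtain T where T: "\<Gamma> \<subseteq> T" "\<not> derives L CS T \<phi>"
    and max: "\<And>S. \<Gamma> \<subseteq> S \<Longrightarrow> \<not> derives L CS S \<phi> \<Longrightarrow> T \<subseteq> S \<Longrightarrow> S = T"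
    by (smt (verit) mem_Collect_eq)
  have imp: "derives L CS T (\<alpha> \<^bold>\<rightarrow> \<phi>)" if "\<not> derives L CS T \<alpha>" for \<alpha>
  proof -
    have "insert \<alpha> T \<noteq> T"
      using that derives.premise by blast
    then have "derives L CS (insert \<alpha> T) \<phi>"
      using max[of "insert \<alpha> T"] T(1) by blast
    then show ?thesis by (rule deduction_theorem)
  qed
  have "derives L CS T (\<alpha> \<^bold>\<rightarrow> \<beta>) \<or> derives L CS T (\<beta> \<^bold>\<rightarrow> \<alpha>)" for \<alpha> \<beta>
    using imp[of "\<alpha> \<^bold>\<rightarrow> \<beta>"] imp[of "\<beta> \<^bold>\<rightarrow> \<alpha>"] T(2) by (meson derives.mp derives_G A6)
  then show ?thesis
    using that T by blast
qed

section \<open>Completeness\<close>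

instance tm :: countable
  by countable_datatype

instance fm :: countable
  by countable_datatype

text \<open>Each element is sent to the sum of the weights \<open>(1/2)^n\<close> of the indices of
  elements below it. Omitting what lies below \<open>b\<close> makes the value of \<open>b\<close>
  zero; dividing by the value of \<open>t\<close> makes the top 1.\<close>

lemma countable_linear_preorder_embeds_unit_interval:
  fixes le :: "'a::countable \<Rightarrow> 'a \<Rightarrow> bool"
  assumes refl: "\<And>a. le a a" and trans: "\<And>a b c. le a b \<Longrightarrow> le b c \<Longrightarrow> le a c"
    and linear: "\<And>a b. le a b \<or> le b a"
    and bot: "\<And>a. le b a" and top: "\<And>a. le a t" and "\<not> le t b"
  obtains f :: "'a \<Rightarrow> real"
  where "\<And>a c. f a \<le> f c \<longleftrightarrow> le a c" "f b = 0" "f t = 1" "\<And>a. f a \<in> {0..1}"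
proof -
  define h :: "'a \<Rightarrow> nat \<Rightarrow> real" where
    "h a n = (if le (from_nat n) a \<and> \<not> le (from_nat n) b then (1/2)^n else 0)" for a n
  have s: "summable (h a)" for a
    by (rule summable_comparison_test[of _ "\<lambda>n. (1/2)^n"]) (auto simp: h_def summable_geometric)
  define g where "g a = suminf (h a)" for a
  have mono: "g a \<le> g c" if "le a c" for a c
    unfolding g_def using trans[OF _ that] by (intro suminf_le s) (auto simp: h_def)
  have strict: "g a < g c" if "\<not> le c a" for a c
  proof -
    have ac: "le a c"
      using linear that by blast
    have "0 < (\<Sum>n. h c n - h a n)"
    \<comment> \<open>The index of \<open>c\<close> itself is counted for \<open>c\<close> but not
      for \<open>a\<close>.\<close>
    proof (rule suminf_pos2[where i = "to_nat c"])
      show "summable (\<lambda>n. h c n - h a n)"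
        by (intro summable_diff s)
      show "0 \<le> h c n - h a n" for n
        using trans[OF _ ac] by (auto simp: h_def)
      \<comment> \<open>Otherwise \<open>c\<close> would lie below \<open>b\<close>, hence below
        \<open>a\<close>; so the weight of \<open>c\<close> is not among the omitted ones.\<close>
      have "\<not> le c b"
        using that bot trans by blast
      then show "0 < h c (to_nat c) - h a (to_nat c)"
        using that refl by (simp add: h_def)
    qed
    then show ?thesis
      using suminf_diff[OF s s, of c a] by (simp add: g_def)
  qed
  have iff: "g a \<le> g c \<longleftrightarrow> le a c" for a c
    using mono strict by (meson not_le)
  have "h b = (\<lambda>_. 0)"
    by (auto simp: h_def)
  then have gb: "g b = 0"
    by (simp add: g_def)
  have gt: "0 < g t"
    using strict[OF assms(6)] gb by simp
  show ?thesis
  proof (rule that[of "\<lambda>a. g a / g t"])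
    show "g a / g t \<le> g c / g t \<longleftrightarrow> le a c" for a c
      using gt iff[of a c] by (simp add: divide_le_cancel)
    show "g a / g t \<in> {0..1}" for a
      using gt mono[OF top[of a]] mono[OF bot[of a]] gb by simp
  qed (use gt gb in auto)
qed

text \<open>The embedding is applied to derivable implication over a linear theory. The clauses for
  the connectives follow because conjunction is the meet and implication the residuum in that
  order.\<close>

lemma goedel_valuation_exists:
  assumes "\<not> derives L CS \<Gamma> \<phi>"
  obtains T and v :: "fm \<Rightarrow> real"
  where "\<Gamma> \<subseteq> T" "v \<phi> < 1" "\<And>\<alpha>. v \<alpha> \<in> {0..1}" "\<And>\<alpha>. derives L CS T \<alpha> \<Longrightarrow> v \<alpha> = 1"
    "v Bot = 0" "\<And>\<alpha> \<beta>. v (\<alpha> \<^bold>\<and> \<beta>) = min (v \<alpha>) (v \<beta>)" "\<And>\<alpha> \<beta>. v (\<alpha> \<^bold>\<rightarrow> \<beta>) = gimp (v \<alpha>) (v \<beta>)"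
proof -
  obtain T where T: "\<Gamma> \<subseteq> T" "\<not> derives L CS T \<phi>"
    and lin: "\<And>\<alpha> \<beta>. derives L CS T (\<alpha> \<^bold>\<rightarrow> \<beta>) \<or> derives L CS T (\<beta> \<^bold>\<rightarrow> \<alpha>)"
    using linear_theory_exists[OF assms] by blast
  let ?D = "derives L CS T"
  \<comment> \<open>The language has no truth constant; this formula serves as the greatest
    element.\<close>
  let ?Top = "Bot \<^bold>\<rightarrow> Bot"
  have Top: "?D (?Top \<^bold>\<rightarrow> \<alpha>) \<longleftrightarrow> ?D \<alpha>" for \<alpha>
    using derives_weaken derives_refl derives.mp by blast
  have Bot: "?D (Bot \<^bold>\<rightarrow> \<alpha>)" for \<alpha>
    by (intro derives_G A7)
  have "\<not> ?D (?Top \<^bold>\<rightarrow> Bot)"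
    using T(2) Top Bot derives.mp by blast
  then obtain v :: "fm \<Rightarrow> real" where le: "\<And>\<alpha> \<beta>. v \<alpha> \<le> v \<beta> \<longleftrightarrow> ?D (\<alpha> \<^bold>\<rightarrow> \<beta>)"
    and v: "v Bot = 0" "v ?Top = 1" "\<And>\<alpha>. v \<alpha> \<in> {0..1}"
    using countable_linear_preorder_embeds_unit_interval[of "\<lambda>\<alpha> \<beta>. ?D (\<alpha> \<^bold>\<rightarrow> \<beta>)" Bot ?Top]
      derives_refl derives_trans lin Bot derives_weaken by metis
  have one: "v \<alpha> = 1 \<longleftrightarrow> ?D \<alpha>" for \<alpha>
    using le[of ?Top \<alpha>] v(2) v(3)[of \<alpha>] Top[of \<alpha>] by auto
  show ?thesis
  proof (rule that[of T v])
    show "v \<phi> < 1"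
      using one[of \<phi>] T(2) v(3)[of \<phi>] by auto
    show "v (\<alpha> \<^bold>\<and> \<beta>) = min (v \<alpha>) (v \<beta>)" for \<alpha> \<beta>
    proof (rule antisym)
      have "?D (\<alpha> \<^bold>\<and> \<beta> \<^bold>\<rightarrow> \<alpha>)" "?D (\<alpha> \<^bold>\<and> \<beta> \<^bold>\<rightarrow> \<beta>)"
        by (meson derives_G derives_trans A2 A3)+
      then show "v (\<alpha> \<^bold>\<and> \<beta>) \<le> min (v \<alpha>) (v \<beta>)"
        by (simp add: le)
      \<comment> \<open>By linearity one conjunct implies the other, hence also the
        conjunction.\<close>
      show "min (v \<alpha>) (v \<beta>) \<le> v (\<alpha> \<^bold>\<and> \<beta>)"
        using lin[of \<alpha> \<beta>] derives_And_intro[of L CS T] derives_refl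
        by (metis le min_le_iff_disj)
    qed
    show "v (\<alpha> \<^bold>\<rightarrow> \<beta>) = gimp (v \<alpha>) (v \<beta>)" for \<alpha> \<beta>
    proof (cases "?D (\<alpha> \<^bold>\<rightarrow> \<beta>)")
      case True
      then show ?thesis by (simp add: gimp_def le one)
    next
      case False
      \<comment> \<open>Linearity compares the implication with \<open>\<alpha>\<close>; the other
        direction would contract to the implication assumed underivable.\<close>
      then have "?D ((\<alpha> \<^bold>\<rightarrow> \<beta>) \<^bold>\<rightarrow> \<alpha>)"
        using lin derives_contract by blast
      then have "?D ((\<alpha> \<^bold>\<rightarrow> \<beta>) \<^bold>\<rightarrow> \<beta>)"
        using derives_S derives_refl by blast
      then have "v (\<alpha> \<^bold>\<rightarrow> \<beta>) = v \<beta>"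
        using derives_K by (intro antisym) (simp_all add: le)
      then show ?thesis
        using False by (simp add: gimp_def le)
    qed
  qed (use T(1) v one in auto)
qed

section \<open>The one-world countermodel\<close>

lemma completeness:
  assumes "entails (crisp_models L CS :: 'w model set) \<Gamma> \<phi>"
  shows "derives L CS \<Gamma> \<phi>"
proof (rule ccontr)
  assume "\<not> derives L CS \<Gamma> \<phi>"
  then obtain T and v :: "fm \<Rightarrow> real" where T: "\<Gamma> \<subseteq> T" and \<phi>: "v \<phi> < 1"
    and unit: "\<And>\<alpha>. v \<alpha> \<in> {0..1}" and one: "\<And>\<alpha>. derives L CS T \<alpha> \<Longrightarrow> v \<alpha> = 1"
    and v: "v Bot = 0" "\<And>\<alpha> \<beta>. v (\<alpha> \<^bold>\<and> \<beta>) = min (v \<alpha>) (v \<beta>)"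
      "\<And>\<alpha> \<beta>. v (\<alpha> \<^bold>\<rightarrow> \<beta>) = gimp (v \<alpha>) (v \<beta>)"
    using goedel_valuation_exists by metis
  have ax: "v \<alpha> \<le> v \<beta>" if "\<alpha> \<^bold>\<rightarrow> \<beta> \<in> axioms_of L" for \<alpha> \<beta>
    using one[OF derives.axiom[OF that]] v(3) unit[of \<alpha>] unit[of \<beta>] by (simp add: gimp_eq_1_iff)
  \<comment> \<open>The value is 0 or 1, so the model is crisp in either case.\<close>
  define r :: real where "r = of_bool (F_axioms \<subseteq> axioms_of L)"
  define M :: "'w model" where
    "M = \<lparr>W = {undefined}, R = \<lambda>_ _. r, E = \<lambda>t \<psi> _. v (t \<^bold>: \<psi>), V = \<lambda>_ p. v (Var p)\<rparr>"
  have sel [simp]: "W M = {undefined}" "R M = (\<lambda>_ _. r)" "E M = (\<lambda>t \<psi> _. v (t \<^bold>: \<psi>))"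
      "V M = (\<lambda>_ p. v (Var p))"
    by (simp_all add: M_def)
  \<comment> \<open>The modal part never lowers the intended value: (F) bounds it when
    \<open>r = 1\<close>, and \<open>gimp\<close> is 1 when \<open>r = 0\<close>.\<close>
  have box: "v (t \<^bold>: \<psi>) \<le> gimp r (v \<psi>)" for t \<psi>
  proof (cases "F_axioms \<subseteq> axioms_of L")
    case True
    then have "t \<^bold>: \<psi> \<^bold>\<rightarrow> \<psi> \<in> axioms_of L"
      by (auto simp: F_axioms_def)
    then show ?thesis
      using ax unit[of "t \<^bold>: \<psi>"] by (auto simp: gimp_def)
  next
    case False
    then show ?thesis
      using unit[of \<psi>] unit[of "t \<^bold>: \<psi>"] by (simp add: gimp_def r_def)
  qed
  \<comment> \<open>Truth lemma: the infimum ranges over one world, and \<open>box\<close> absorbs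
    it.\<close>
  have ev: "eval M undefined \<psi> = v \<psi>" for \<psi>
    by (induction \<psi>) (simp_all add: v Inf01_def min_absorb1 box)
  have GJ: "GJ_model M"
    unfolding GJ_model_def
  proof (intro conjI allI ballI)
    show "min (E M t (\<alpha> \<^bold>\<rightarrow> \<beta>) w) (E M s \<alpha> w) \<le> E M (App t s) \<beta> w" for t s \<alpha> \<beta> w
    proof -
      have "v (t \<^bold>: (\<alpha> \<^bold>\<rightarrow> \<beta>)) \<le> v (s \<^bold>: \<alpha> \<^bold>\<rightarrow> App t s \<^bold>: \<beta>)"
        using GJ_axioms_subset by (intro ax) (blast intro: J)
      then show ?thesis
        using unit[of "t \<^bold>: (\<alpha> \<^bold>\<rightarrow> \<beta>)"] by (simp add: v le_gimp_iff)
    qed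
    show "max (E M t \<alpha> w) (E M s \<alpha> w) \<le> E M (Plus t s) \<alpha> w" for t s \<alpha> w
    proof -
      have "v (t \<^bold>: \<alpha>) \<le> v (Plus t s \<^bold>: \<alpha>)" "v (s \<^bold>: \<alpha>) \<le> v (Plus t s \<^bold>: \<alpha>)"
        using GJ_axioms_subset by (blast intro: ax Plus_left Plus_right)+
      then show ?thesis by simp
    qed
  qed (use unit in \<open>auto simp: r_def\<close>)
  have refl: "reflexive_model M" if "F_axioms \<subseteq> axioms_of L"
    using that by (simp add: reflexive_model_def r_def)
  have GJ4: "GJ4_model M" if "PI_axioms \<subseteq> axioms_of L"
  proof -
    have "v (t \<^bold>: \<alpha>) \<le> v (Bang t \<^bold>: t \<^bold>: \<alpha>)" for t \<alpha>
      using that by (intro ax) (auto simp: PI_axioms_def)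
    \<comment> \<open>With one world, monotonicity of evidence and transitivity hold trivially; only
      the condition on \<open>Bang\<close> draws on an axiom.\<close>
    then show ?thesis using GJ by (simp add: GJ4_model_def)
  qed
  have GJ45: "GJ45_model M" if "PI_axioms \<subseteq> axioms_of L" "NI_axioms \<subseteq> axioms_of L"
  proof -
    have "gneg (v (t \<^bold>: \<alpha>)) \<le> v (Query t \<^bold>: Neg (t \<^bold>: \<alpha>))" for t \<alpha>
    proof -
      have "v (Neg (t \<^bold>: \<alpha>)) \<le> v (Query t \<^bold>: Neg (t \<^bold>: \<alpha>))"
        using that(2) by (intro ax) (auto simp: NI_axioms_def)
      moreover have "gneg (v (t \<^bold>: \<alpha>)) = v (Neg (t \<^bold>: \<alpha>))"
        using unit[of "t \<^bold>: \<alpha>"] by (simp add: v gneg_def gimp_def)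
      ultimately show ?thesis by simp
    qed
    \<comment> \<open>Strong evidence holds with equality by \<open>ev\<close>.\<close>
    then show ?thesis
      using GJ4[OF that(1)] by (simp add: GJ45_model_def ev del: eval.simps)
  qed
  have "model_of L M"
    using GJ refl GJ4 GJ45 by (cases L) auto
  moreover have "respects_CS M CS"
    using one derives.const by (auto simp: respects_CS_def)
  moreover have "crisp_model M"
    by (simp add: crisp_model_def r_def)
  ultimately have "M \<in> crisp_models L CS"
    by (simp add: crisp_models_def models_def)
  moreover have "v \<psi> = 1" if "\<psi> \<in> \<Gamma>" for \<psi>
    using one derives.premise T that by blast
  ultimately have "v \<phi> = 1"
    using assms ev unfolding entails_def by (metis sel(1) singletonI)
  then show False
    using \<phi> by simp
qed

text \<open>The implications close a cycle (i), (ii), (iii), (iv), (i). The type \<open>'w\<close>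
  can be arbitrary: soundness holds over every carrier, and the countermodel needs a single
  world.\<close>

theorem mainTheorem1:
  fixes L :: logic and CS \<Gamma> :: "fm set" and \<phi> :: fm
  assumes "constant_specification L CS"
  shows "(derives L CS \<Gamma> \<phi> \<longleftrightarrow> entails_le (models L CS :: 'w model set) \<Gamma> \<phi>) \<and>
         (derives L CS \<Gamma> \<phi> \<longleftrightarrow> entails (models L CS :: 'w model set) \<Gamma> \<phi>) \<and>
         (derives L CS \<Gamma> \<phi> \<longleftrightarrow> entails (crisp_models L CS :: 'w model set) \<Gamma> \<phi>)"
proof -
  have "entails (crisp_models L CS :: 'w model set) \<Gamma> \<phi>"
    if "entails (models L CS :: 'w model set) \<Gamma> \<phi>"
    using that by (auto simp: entails_def crisp_models_def)
  then show ?thesis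
    using soundness[OF assms] entails_le_imp_entails completeness by blast
qed

end
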